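(* Let $M$ be an integer matrix with $n$ columns. If $M$ is null-diagonal, then $M$ is an AP-matrix. That is: if $\dim N(M)\ge 2$ and $(1,1,\ldots,1)\in N(M)$, then there is a $k\in\mathbb{N}$ such that for all $a,d\in\mathbb{N}$ there is a vector $v=(v_1,\ldots,v_n)\in N(M)$ with $v_1,\ldots,v_n\in\mathbb{N}$ not all equal and $v_1,\ldots,v_n\in \mathrm{AP}(k,a,d)$.
   Context: $\mathbb{N}=\{1,2,3,\ldots\}$. For integers $k,d\ge 1$ and $a\ge 0$, the arithmetic progression of length $k$, base $a$ and step $d$ is the set $\mathrm{AP}(k,a,d)=\{a+\lambda d \mid \lambda\in\mathbb{Z},\ 0\le\lambda<k\}$. For an integer matrix $M$ with $n$ columns, $N(M)=\{x\in\mathbb{R}^n : Mx=0\}$ denotes its nullspace. $M$ is called null-diagonal if $\dim N(M)\ge 2$ and $(1,1,\ldots,1)\in N(M)$. $M$ is called an AP-matrix if there is a $k\in\mathbb{N}$ such that for each $a,d\in\mathbb{N}$ there is a vector $v=(v_1,\ldots,v_n)\in N(M)$ such that $v_1,\ldots,v_n\in\mathbb{N}$ are not all equal and $v_1,\ldots,v_n\in\mathrm{AP}(k,a,d)$. *)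

theory Defs
  imports "HOL-Analysis.Analysis"
begin

definition AP :: "nat \<Rightarrow> nat \<Rightarrow> nat \<Rightarrow> nat set" where
  "AP k a d = {a + l * d | l. l < k}"

definition nullspace :: "int ^ 'n ^ 'm \<Rightarrow> (real ^ 'n) set" where
  "nullspace M = {x. map_matrix real_of_int M *v x = 0}"

definition null_diagonal :: "int ^ 'n ^ 'm \<Rightarrow> bool" where
  "null_diagonal M \<longleftrightarrow> dim (nullspace M) \<ge> 2 \<and> (\<chi> i. 1) \<in> nullspace M"

(* The positive integers are rendered as elements of type nat that are at least 1. *)
definition AP_matrix :: "int ^ 'n ^ 'm \<Rightarrow> bool" where
  "AP_matrix M \<longleftrightarrow>
     (\<exists>k\<ge>1. \<forall>a\<ge>1. \<forall>d\<ge>1. \<exists>v :: nat ^ 'n.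
        (\<chi> i. real (v $ i)) \<in> nullspace M \<and>
        (\<forall>i. v $ i \<ge> 1) \<and>
        (\<exists>i j. v $ i \<noteq> v $ j) \<and>
        (\<forall>i. v $ i \<in> AP k a d))"

end

theory Submission
  imports Defs
begin

text \<open>
  A non-constant real solution of an integer system yields a non-constant rational one: apply to
  every coordinate a \<open>\<rat>\<close>-linear functional \<open>\<real> \<rightarrow> \<rat>\<close> that does not vanish on the difference of two
  distinct coordinates. Clearing denominators and adding a multiple of the all-ones vector gives
  a non-constant solution \<open>w\<close> with natural entries. Then \<open>a + d w\<close> is a solution for all \<open>a\<close> and \<open>d\<close>,
  so \<open>k = max w + 1\<close> works uniformly.
\<close>

text \<open>Over the field of rationals, a nonzero real forms a linearly independent singleton. The
  prescription sending \<open>x\<close> to 1 therefore extends linearly to all of the reals.\<close>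

lemma rational_functional_exists:
  fixes x :: real
  assumes "x \<noteq> 0"
  obtains \<phi> :: "real \<Rightarrow> rat"
  where "\<And>u v. \<phi> (u + v) = \<phi> u + \<phi> v" "\<And>q u. \<phi> (of_rat q * u) = q * \<phi> u" "\<phi> x = 1"
proof -
  interpret vector_space_pair "\<lambda>(q::rat) (r::real). of_rat q * r" "(*) :: rat \<Rightarrow> rat \<Rightarrow> rat"
    by unfold_locales (simp_all add: algebra_simps of_rat_add of_rat_mult)
  have "vs1.independent {x}"
    using assms by simp
  then obtain \<phi> where \<phi>: "Vector_Spaces.linear (\<lambda>q r. of_rat q * r) (*) \<phi>" "\<phi> x = 1"
    using linear_independent_extend[of "{x}" "\<lambda>_. 1"] by auto
  interpret Vector_Spaces.linear "\<lambda>(q::rat) (r::real). of_rat q * r" "(*) :: rat \<Rightarrow> rat \<Rightarrow> rat" \<phi>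
    by (rule \<phi>(1))
  show thesis
    using that add scale \<phi>(2) by blast
qed

lemma common_denominator:
  fixes y :: "'a::finite \<Rightarrow> rat"
  obtains N :: int and z :: "'a \<Rightarrow> int" where "N > 0" "\<And>i. of_int (z i) = of_int N * y i"
proof
  define den where "den i = snd (quotient_of (y i))" for i
  \<comment> \<open>Multiplying the numerator by all the other denominators keeps \<open>z i\<close>
    integral without any division.\<close>
  define z where "z i = fst (quotient_of (y i)) * (\<Prod>j\<in>UNIV - {i}. den j)" for i
  have den_pos: "den i > 0" for i
    unfolding den_def by (rule quotient_of_denom_pos')
  then show "(\<Prod>i\<in>UNIV. den i) > 0"
    by (simp add: prod_pos)
  show "of_int (z i) = of_int (\<Prod>i\<in>UNIV. den i) * y i" for i
  proof -
    have "y i = of_int (fst (quotient_of (y i))) / of_int (den i)"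
      unfolding den_def by (rule quotient_of_div) simp
    then have "of_int (fst (quotient_of (y i))) = of_int (den i) * y i"
      using den_pos[of i] by (simp add: field_simps)
    moreover have "(\<Prod>i\<in>UNIV. den i) = den i * (\<Prod>j\<in>UNIV - {i}. den j)"
      by (simp add: prod.remove)
    ultimately show ?thesis
      by (simp add: z_def)
  qed
qed

lemma mem_nullspace_iff:
  "x \<in> nullspace M \<longleftrightarrow> (\<forall>r. (\<Sum>i\<in>UNIV. real_of_int (M $ r $ i) * x $ i) = 0)"
  by (simp add: nullspace_def map_matrix_def matrix_vector_mult_def vec_eq_iff)

text \<open>Otherwise the nullspace would lie in the line spanned by the all-ones vector, and its
  dimension would be at most 1.\<close>

lemma nonconstant_vector_in_nullspace:
  fixes M :: "int ^ 'n ^ 'm"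
  assumes "dim (nullspace M) \<ge> 2"
  obtains x i j where "x \<in> nullspace M" "x $ i \<noteq> x $ j"
proof (rule ccontr)
  assume "\<not> thesis"
  then have const: "x $ i = x $ j" if "x \<in> nullspace M" for x i j
    using that \<open>\<And>x i j. x \<in> nullspace M \<Longrightarrow> x $ i \<noteq> x $ j \<Longrightarrow> thesis\<close> by blast
  have "nullspace M \<subseteq> span {\<chi> i. 1}"
  proof
    fix x assume "x \<in> nullspace M"
    \<comment> \<open>All coordinates of \<open>x\<close> agree, so \<open>undefined\<close> just
      names an arbitrary index.\<close>
    then have "x = x $ undefined *\<^sub>R (\<chi> i. 1)"
      using const by (simp add: vec_eq_iff)
    then show "x \<in> span {\<chi> i. 1}"
      by (metis span_base span_scale insertI1)
  qed
  then have "dim (nullspace M) \<le> card {(\<chi> i. 1) :: real ^ 'n}"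
    by (rule dim_le_card) simp
  with assms show False
    by simp
qed

lemma nonconstant_integer_solution:
  fixes M :: "int ^ 'n ^ 'm"
  assumes "x \<in> nullspace M" "x $ i \<noteq> x $ j"
  obtains z :: "'n \<Rightarrow> int" where "\<And>r. (\<Sum>i\<in>UNIV. M $ r $ i * z i) = 0" "z i \<noteq> z j"
proof -
  have "x $ i - x $ j \<noteq> 0"
    using assms(2) by simp
  then obtain \<phi> :: "real \<Rightarrow> rat" where add: "\<And>u v. \<phi> (u + v) = \<phi> u + \<phi> v"
    and scale: "\<And>q u. \<phi> (of_rat q * u) = q * \<phi> u" and one: "\<phi> (x $ i - x $ j) = 1"
    by (rule rational_functional_exists) blast
  obtain N :: int and z where N: "N > 0" and z: "\<And>i. of_int (z i) = of_int N * \<phi> (x $ i)"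
    by (rule common_denominator[of "\<lambda>i. \<phi> (x $ i)"]) blast
  have zero: "\<phi> 0 = 0"
    using scale[of 0 0] by simp
  have \<phi>_sum: "\<phi> (\<Sum>i\<in>A. f i) = (\<Sum>i\<in>A. \<phi> (f i))" if "finite A" for A :: "'n set" and f
    using that by induction (simp_all add: zero add)
  have "(\<Sum>i\<in>UNIV. M $ r $ i * z i) = 0" for r
  proof -
    have "of_int (\<Sum>i\<in>UNIV. M $ r $ i * z i)
        = of_int N * (\<Sum>i\<in>UNIV. of_int (M $ r $ i) * \<phi> (x $ i))"
      by (simp add: z sum_distrib_left mult_ac)
    \<comment> \<open>Integer entries are rational scalars, so \<phi> commutes with the combination
      given by row \<open>r\<close>, which vanishes at \<open>x\<close>.\<close>
    also have "(\<Sum>i\<in>UNIV. of_int (M $ r $ i) * \<phi> (x $ i))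
        = (\<Sum>i\<in>UNIV. \<phi> (of_int (M $ r $ i) * x $ i))"
      by (metis scale of_rat_of_int_eq)
    also have "\<dots> = \<phi> (\<Sum>i\<in>UNIV. of_int (M $ r $ i) * x $ i)"
      by (simp add: \<phi>_sum)
    also have "\<dots> = 0"
      using assms(1) zero by (simp add: mem_nullspace_iff)
    finally show ?thesis
      by (simp only: mult_zero_right of_int_eq_0_iff)
  qed
  \<comment> \<open>By additivity the two images differ by \<phi> of the difference, which is 1;
    scaling by \<open>N > 0\<close> keeps them apart.\<close>
  moreover have "\<phi> (x $ i) \<noteq> \<phi> (x $ j)"
    using add[of "x $ i - x $ j" "x $ j"] one by simp
  then have "z i \<noteq> z j"
    using z[of i] z[of j] N by auto
  ultimately show thesis
    by (rule that)
qed

theorem theorem9: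
  fixes M :: "int ^ 'n ^ 'm"
  assumes "null_diagonal M"
  shows "AP_matrix M"
proof -
  \<comment> \<open>This is membership of the all-ones vector in the nullspace; it makes solutions
    stable under adding constants.\<close>
  have rows: "(\<Sum>i\<in>UNIV. M $ r $ i) = 0" for r
  proof -
    have "real_of_int (\<Sum>i\<in>UNIV. M $ r $ i) = 0"
      using assms by (simp add: null_diagonal_def mem_nullspace_iff)
    then show ?thesis
      by (simp only: of_int_eq_0_iff)
  qed
  have "dim (nullspace M) \<ge> 2"
    using assms by (simp add: null_diagonal_def)
  then obtain x p q where "x \<in> nullspace M" "x $ p \<noteq> x $ q"
    by (rule nonconstant_vector_in_nullspace)
  then obtain z :: "'n \<Rightarrow> int"
    where z: "\<And>r. (\<Sum>i\<in>UNIV. M $ r $ i * z i) = 0" and pq: "z p \<noteq> z q"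
    by (rule nonconstant_integer_solution) blast
  \<comment> \<open>Subtracting the minimum makes every entry nonnegative, so \<open>nat\<close>
    truncates nothing.\<close>
  define w where "w i = nat (z i - Min (range z))" for i
  have w: "int (w i) = z i - Min (range z)" for i
    by (simp add: w_def)
  \<comment> \<open>The bound in \<open>AP\<close> is strict, hence the added 1, which also ensures
    \<open>k \<ge> 1\<close>. Neither \<open>a\<close> nor \<open>d\<close> enters.\<close>
  define k where "k = Max (range w) + 1"
  have "\<exists>v :: nat ^ 'n. (\<chi> i. real (v $ i)) \<in> nullspace M \<and> (\<forall>i. v $ i \<ge> 1) \<and>
      (\<exists>i j. v $ i \<noteq> v $ j) \<and> (\<forall>i. v $ i \<in> AP k a d)" if "a \<ge> 1" "d \<ge> 1" for a d
  proof (intro exI[of _ "\<chi> i. a + w i * d"] conjI allI)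
    have "(\<Sum>i\<in>UNIV. M $ r $ i * int (a + w i * d)) = 0" for r
    proof -
      \<comment> \<open>The vector is a constant plus \<open>d\<close> times \<open>z\<close>: the
        constant part vanishes by the row sums, the rest because \<open>z\<close> is a
        solution.\<close>
      have "(\<Sum>i\<in>UNIV. M $ r $ i * int (a + w i * d))
          = (\<Sum>i\<in>UNIV. (int a - Min (range z) * int d) * M $ r $ i + int d * (M $ r $ i * z i))"
        by (simp add: w algebra_simps)
      also have "\<dots> = 0"
        by (simp add: sum.distrib rows z flip: sum_distrib_left)
      finally show ?thesis .
    qed
    then have "real_of_int (\<Sum>i\<in>UNIV. M $ r $ i * int (a + w i * d)) = 0" for r
      by (simp only: of_int_0)
    then show "(\<chi> i. real ((\<chi> i. a + w i * d) $ i)) \<in> nullspace M"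
      by (simp add: mem_nullspace_iff)
    show "\<exists>i j. (\<chi> i. a + w i * d) $ i \<noteq> (\<chi> i. a + w i * d) $ j"
    proof (intro exI)
      have "w p \<noteq> w q"
        using w[of p] w[of q] pq by auto
      \<comment> \<open>Distinctness survives the scaling because \<open>d \<ge> 1\<close>.\<close>
      with that show "(\<chi> i. a + w i * d) $ p \<noteq> (\<chi> i. a + w i * d) $ q"
        by simp
    qed
    show "(\<chi> i. a + w i * d) $ i \<in> AP k a d" for i
      by (auto simp: AP_def k_def less_Suc_eq_le)
  qed (use that in simp)
  then show ?thesis
    unfolding AP_matrix_def by (intro exI[of _ k]) (simp add: k_def)
qed

end
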